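(* For every nonzero $u\in l^2(\mathbb{Z}^2)$ with $\|u\|=1$ replaced by homogeneity, that is, writing $x=\|\nabla u\|^2/\|u\|^2$, in the normalization $\|u\|=1$ one has $$u(0,0)^2\le\frac1{4\pi}\,x\left(1-\frac{x}{8}\right)\left(\ln\frac{16}{x(8-x)}+\ln\left(1+\ln\frac{16}{x(8-x)}\right)+2\pi\right);$$ equivalently, for every nonzero $u\in l^2(\mathbb{Z}^2)$ the quantity $u(0,0)^2/\|u\|^2$ is bounded by the right-hand side. The constants in front of the two logarithms (both equal to $1$ inside the large bracket) and the constant $2\pi$ are sharp: none of these three constants can be replaced by a smaller one with the other two unchanged. The inequality becomes an equality for $u=\delta$ (and its nonzero multiples); otherwise, for nonzero $u$, the inequality is strict.
   Context: Sequences are real-valued. For $u\in l^2(\mathbb{Z}^2)$: $\mathrm{D}_1u(n,m)=u(n+1,m)-u(n,m)$, $\mathrm{D}_2u(n,m)=u(n,m+1)-u(n,m)$, $\|\cdot\|$ is the $l^2$-norm, $\|\nabla u\|^2=\|\mathrm{D}_1u\|^2+\|\mathrm{D}_2u\|^2$. One has $0<\|\nabla u\|^2<8\|u\|^2$ for $u\ne0$. The sequence $\delta$ equals $1$ at $(0,0)$ and $0$ elsewhere. *)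

theory Defs
  imports "HOL-Analysis.Analysis"
begin

definition l2_Z2 :: "(int \<times> int \<Rightarrow> real) set" where
  "l2_Z2 = {u. (\<lambda>p. (u p)\<^sup>2) summable_on UNIV}"

text \<open>Meaningful only on \<open>l2_Z2\<close>: \<open>infsum\<close> returns 0 for a family that is not summable.\<close>

definition l2_norm :: "(int \<times> int \<Rightarrow> real) \<Rightarrow> real" where
  "l2_norm u = sqrt (\<Sum>\<^sub>\<infinity>p. (u p)\<^sup>2)"

definition D1 :: "(int \<times> int \<Rightarrow> real) \<Rightarrow> int \<times> int \<Rightarrow> real" where
  "D1 u = (\<lambda>(n, m). u (n + 1, m) - u (n, m))"

definition D2 :: "(int \<times> int \<Rightarrow> real) \<Rightarrow> int \<times> int \<Rightarrow> real" where
  "D2 u = (\<lambda>(n, m). u (n, m + 1) - u (n, m))"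

text \<open>The square \<open>\<parallel>\<nabla>u\<parallel>\<^sup>2\<close>, not the norm itself.\<close>

definition grad_norm_sq :: "(int \<times> int \<Rightarrow> real) \<Rightarrow> real" where
  "grad_norm_sq u = (l2_norm (D1 u))\<^sup>2 + (l2_norm (D2 u))\<^sup>2"

definition delta :: "int \<times> int \<Rightarrow> real" where
  "delta p = (if p = (0, 0) then 1 else 0)"

text \<open>
  The right-hand side of the inequality, with arbitrary constants \<open>a\<close> and \<open>b\<close> in front of the
  two logarithms and additive constant \<open>c\<close>. The inequality itself is the case
  \<open>a = b = 1\<close>, \<open>c = 2 * pi\<close>. For \<open>0 < x < 8\<close> one has \<open>0 < x * (8 - x) \<le> 16\<close>, so both
  logarithms are then taken of numbers \<open>\<ge> 1\<close>.
\<close>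

definition log_bound :: "real \<Rightarrow> real \<Rightarrow> real \<Rightarrow> real \<Rightarrow> real" where
  "log_bound a b c x =
     1 / (4 * pi) * x * (1 - x / 8) *
       (a * ln (16 / (x * (8 - x))) + b * ln (1 + ln (16 / (x * (8 - x)))) + c)"

definition ineq_holds :: "real \<Rightarrow> real \<Rightarrow> real \<Rightarrow> bool" where
  "ineq_holds a b c \<longleftrightarrow>
     (\<forall>u \<in> l2_Z2. u \<noteq> (\<lambda>_. 0) \<longrightarrow>
        (u (0, 0))\<^sup>2 / (l2_norm u)\<^sup>2 \<le> log_bound a b c (grad_norm_sq u / (l2_norm u)\<^sup>2))"

end

(* With P the average over the four neighbours and x = 4 - 4 r, r = <P u, u> / <u, u>, the form
   <(1 - k P) u, u> is nonnegative for |k| <= 1, and Cauchy-Schwarz for it against the truncated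
   resolvents sum_{n<N} k^n P^n delta gives
     u(0,0)^2 <= (1 - k r) |u|^2 * sum_n p_n k^n,
   where p_n is the return probability of the planar simple random walk. As p_(2n) is the square of
   (2n choose n) / 4^n, at most 1 / (pi n) by Wallis' product, the series is at most
   1 - ln (1 - k^2) / pi, and a suitable k makes the bound elementary. Since also
   p_(2n) >= 1 / (pi (n + 1)), the Green sums sum_{n<N} P^n delta show sharpness of the two logarithmic
   terms as N tends to infinity, while c = 2 pi is forced by equality at delta. *)

theory Submission
  imports Defs "HOL-Real_Asymp.Real_Asymp"
begin

section \<open>Inner product, shifts and the averaging operator on l2(Z^2)\<close>

definition ip :: "(int \<times> int \<Rightarrow> real) \<Rightarrow> (int \<times> int \<Rightarrow> real) \<Rightarrow> real" where
  "ip f g = (\<Sum>\<^sub>\<infinity>p. f p * g p)"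

definition shift :: "int \<times> int \<Rightarrow> (int \<times> int \<Rightarrow> real) \<Rightarrow> int \<times> int \<Rightarrow> real" where
  "shift e f = (\<lambda>p. f (p + e))"

definition avg :: "(int \<times> int \<Rightarrow> real) \<Rightarrow> int \<times> int \<Rightarrow> real" where
  "avg f = (\<lambda>p. (f (p + (1, 0)) + f (p + (- 1, 0)) + f (p + (0, 1)) + f (p + (0, - 1))) / 4)"

text \<open>The law after \<open>n\<close> steps of the simple random walk on Z^2 started at the
  origin, obtained as the \<open>n\<close>-th power of \<open>avg\<close> applied to
  \<open>delta\<close>.\<close>

primrec walk :: "nat \<Rightarrow> int \<times> int \<Rightarrow> real" where
  "walk 0 = delta"
| "walk (Suc n) = avg (walk n)"

definition ret :: "nat \<Rightarrow> real" where
  "ret n = walk n (0, 0)"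

lemma summable_on_mult_l2:
  assumes "f \<in> l2_Z2" "g \<in> l2_Z2"
  shows "(\<lambda>p. f p * g p) summable_on UNIV"
proof -
  have "(\<lambda>p. norm (f p * g p)) summable_on UNIV"
  proof (rule Infinite_Sum.abs_summable_on_comparison_test')
    show "(\<lambda>p. (f p)\<^sup>2 + (g p)\<^sup>2) summable_on UNIV"
      using assms by (intro summable_on_add) (auto simp: l2_Z2_def)
    show "norm (f p * g p) \<le> (f p)\<^sup>2 + (g p)\<^sup>2" for p
      using sum_squares_bound[of "\<bar>f p\<bar>" "\<bar>g p\<bar>"] abs_ge_zero[of "f p * g p"]
      unfolding real_norm_def abs_mult power2_abs by linarith
  qed
  then show ?thesis
    by (rule abs_summable_summable)
qed

lemma l2_lin:
  assumes "f \<in> l2_Z2" "g \<in> l2_Z2"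
  shows "(\<lambda>p. a * f p + b * g p) \<in> l2_Z2"
proof -
  have "(\<lambda>p. a\<^sup>2 * (f p)\<^sup>2 + 2 * a * b * (f p * g p) + b\<^sup>2 * (g p)\<^sup>2) summable_on UNIV"
    using assms summable_on_mult_l2[OF assms]
    by (intro summable_on_add summable_on_cmult_right) (auto simp: l2_Z2_def)
  moreover have "(\<lambda>p. (a * f p + b * g p)\<^sup>2)
      = (\<lambda>p. a\<^sup>2 * (f p)\<^sup>2 + 2 * a * b * (f p * g p) + b\<^sup>2 * (g p)\<^sup>2)"
    by (auto simp: power2_eq_square algebra_simps)
  ultimately show ?thesis
    by (simp add: l2_Z2_def)
qed

lemma zero_l2: "(\<lambda>p. 0) \<in> l2_Z2"
  by (simp add: l2_Z2_def)

lemma sum_l2: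
  assumes "\<And>i. i \<in> I \<Longrightarrow> f i \<in> l2_Z2"
  shows "(\<lambda>p. \<Sum>i\<in>I. c i * f i p) \<in> l2_Z2"
  using assms
proof (induction I rule: infinite_finite_induct)
  case (insert i I)
  then show ?case
    using l2_lin[of "f i" "\<lambda>p. \<Sum>i\<in>I. c i * f i p" "c i" 1] by simp
qed (auto simp: zero_l2)

lemma ip_commute: "ip f g = ip g f"
  by (simp add: ip_def mult.commute)

lemma ip_lin:
  assumes "f \<in> l2_Z2" "g \<in> l2_Z2" "h \<in> l2_Z2"
  shows "ip (\<lambda>p. a * f p + b * g p) h = a * ip f h + b * ip g h"
proof -
  have "ip (\<lambda>p. a * f p + b * g p) h = (\<Sum>\<^sub>\<infinity>p. a * (f p * h p) + b * (g p * h p))"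
    by (simp add: ip_def algebra_simps)
  also have "\<dots> = a * ip f h + b * ip g h"
    using assms by (simp add: ip_def infsum_add infsum_cmult_right summable_on_mult_l2 summable_on_cmult_right)
  finally show ?thesis .
qed

lemma ip_lin_right:
  assumes "f \<in> l2_Z2" "g \<in> l2_Z2" "h \<in> l2_Z2"
  shows "ip h (\<lambda>p. a * f p + b * g p) = a * ip h f + b * ip h g"
  using ip_lin[OF assms] by (simp add: ip_commute)

lemma ip_sum:
  assumes "finite I" "\<And>i. i \<in> I \<Longrightarrow> f i \<in> l2_Z2" "h \<in> l2_Z2"
  shows "ip (\<lambda>p. \<Sum>i\<in>I. c i * f i p) h = (\<Sum>i\<in>I. c i * ip (f i) h)"
  using assms(1,2)
proof (induction I rule: finite_induct)
  case empty
  then show ?case by (simp add: ip_def)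
next
  case (insert i I)
  then show ?case
    using ip_lin[of "f i" "\<lambda>p. \<Sum>i\<in>I. c i * f i p" h "c i" 1] sum_l2[of I f c] assms(3)
    by simp
qed

lemma ip_self_nonneg: "0 \<le> ip f f"
  by (simp add: ip_def infsum_nonneg)

lemma ip_self_eq_0D:
  assumes "f \<in> l2_Z2" "ip f f \<le> 0"
  shows "f p = 0"
  using nonneg_infsum_le_0D[of "\<lambda>p. f p * f p" UNIV p] assms summable_on_mult_l2[of f f]
  by (simp add: ip_def)

lemma l2_norm_sq: "(l2_norm f)\<^sup>2 = ip f f"
  using ip_self_nonneg[of f] by (simp add: l2_norm_def ip_def power2_eq_square)

lemma ip_diff:
  assumes "f \<in> l2_Z2" "g \<in> l2_Z2" "f' \<in> l2_Z2" "g' \<in> l2_Z2"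
  shows "ip (\<lambda>p. f p - t * g p) (\<lambda>p. f' p - t * g' p)
    = ip f f' - t * ip f g' - t * ip g f' + t\<^sup>2 * ip g g'"
proof -
  have l: "(\<lambda>p. f' p - t * g' p) \<in> l2_Z2"
    using l2_lin[OF assms(3,4), of 1 "-t"] by simp
  have "ip h (\<lambda>p. f' p - t * g' p) = ip h f' - t * ip h g'" if "h \<in> l2_Z2" for h
    using ip_lin_right[OF assms(3,4) that, of 1 "-t"] by simp
  note * = this[OF assms(1)] this[OF assms(2)]
  have "ip (\<lambda>p. f p - t * g p) (\<lambda>p. f' p - t * g' p)
      = ip f (\<lambda>p. f' p - t * g' p) - t * ip g (\<lambda>p. f' p - t * g' p)"
    using ip_lin[OF assms(1,2) l, of 1 "-t"] by simp
  then show ?thesis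
    by (simp only: *) (simp add: power2_eq_square algebra_simps)
qed

lemma ip_diff_self:
  assumes "f \<in> l2_Z2" "g \<in> l2_Z2"
  shows "ip (\<lambda>p. f p - t * g p) (\<lambda>p. f p - t * g p) = ip f f - 2 * t * ip f g + t\<^sup>2 * ip g g"
  using ip_diff[OF assms assms] by (simp add: ip_commute[of g f])

lemma abs_ip_le:
  assumes "f \<in> l2_Z2" "g \<in> l2_Z2"
  shows "\<bar>ip f g\<bar> \<le> (ip f f + ip g g) / 2"
  using ip_diff_self[OF assms, of 1] ip_self_nonneg[of "\<lambda>p. f p - 1 * g p"]
    ip_diff_self[OF assms, of "-1"] ip_self_nonneg[of "\<lambda>p. f p - (- 1) * g p"]
  by (simp add: abs_le_iff)

lemma bij_add: "bij (\<lambda>p::int \<times> int. p + e)"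
  by (rule bij_betw_byWitness[where f' = "\<lambda>p. p - e"]) auto

lemma shift_l2:
  assumes "f \<in> l2_Z2"
  shows "shift e f \<in> l2_Z2"
  using assms summable_on_reindex_bij_betw[OF bij_add, of "\<lambda>p. (f p)\<^sup>2" e]
  by (simp add: l2_Z2_def shift_def)

lemma ip_shift: "ip (shift e f) g = ip f (shift (- e) g)"
  unfolding ip_def shift_def
  using infsum_reindex_bij_betw[OF bij_add, of "\<lambda>p. f p * g (p - e)" e] by simp

lemma ip_shift_self: "ip (shift e f) (shift e f) = ip f f"
  by (simp add: ip_shift) (simp add: shift_def)

text \<open>Nested two-term combinations with explicit coefficients match the patterns of
  \<open>l2_lin\<close> and \<open>ip_lin\<close> literally, so both apply by plain rewriting; the
  term \<open>0 * f p\<close> supplies the second summand of the outermost one.\<close>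

lemma avg_eq_shift:
  "avg f = (\<lambda>p. 1/4 * (1 * (1 * shift (1,0) f p + 1 * shift (-1,0) f p)
                     + 1 * (1 * shift (0,1) f p + 1 * shift (0,-1) f p)) + 0 * f p)"
  by (auto simp: avg_def shift_def)

lemma avg_l2: "f \<in> l2_Z2 \<Longrightarrow> avg f \<in> l2_Z2"
  unfolding avg_eq_shift by (intro l2_lin shift_l2)

lemma ip_avg_shift:
  assumes "f \<in> l2_Z2" "g \<in> l2_Z2"
  shows "ip (avg f) g = (ip (shift (1,0) f) g + ip (shift (-1,0) f) g
                       + ip (shift (0,1) f) g + ip (shift (0,-1) f) g) / 4"
  unfolding avg_eq_shift by (simp only: ip_lin l2_lin shift_l2 assms) simp

text \<open>The adjoint of a shift by \<open>e\<close> is the shift by \<open>- e\<close>, and the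
  four unit steps are closed under sign change.\<close>

lemma ip_avg:
  assumes "f \<in> l2_Z2" "g \<in> l2_Z2"
  shows "ip (avg f) g = ip f (avg g)"
proof -
  have "ip (shift e f) g = ip (shift (- e) g) f" for e
    by (rule trans[OF ip_shift ip_commute])
  from this[of "(1,0)"] this[of "(-1,0)"] this[of "(0,1)"] this[of "(0,-1)"]
  have "ip (avg f) g = ip (avg g) f"
    unfolding ip_avg_shift[OF assms] ip_avg_shift[OF assms(2,1)] by simp
  then show ?thesis
    by (rule trans[OF _ ip_commute])
qed

lemma ip_avg_self:
  assumes "f \<in> l2_Z2"
  shows "ip (avg f) f = (ip (shift (1,0) f) f + ip (shift (0,1) f) f) / 2"
proof -
  have "ip (shift e f) f = ip (shift (- e) f) f" for e
    by (rule trans[OF ip_shift ip_commute])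
  from this[of "(1,0)"] this[of "(0,1)"]
show ?thesis
    using ip_avg_shift[OF assms assms] by simp
qed

lemma abs_ip_avg_le:
  assumes "f \<in> l2_Z2"
  shows "\<bar>ip (avg f) f\<bar> \<le> ip f f"
  using abs_ip_le[OF shift_l2[OF assms] assms, of "(1,0)"] abs_ip_le[OF shift_l2[OF assms] assms, of "(0,1)"]
  by (simp add: ip_avg_self[OF assms] ip_shift_self)

lemma avg_form_nonneg:
  assumes "f \<in> l2_Z2" "\<bar>k\<bar> \<le> 1"
  shows "0 \<le> ip f f - k * ip (avg f) f"
proof -
  have "\<bar>k * ip (avg f) f\<bar> \<le> 1 * ip f f"
    unfolding abs_mult using assms abs_ip_avg_le by (intro mult_mono) auto
  then show ?thesis by linarith
qed

text \<open>Shifts preserve the norm, so |shift u - u|^2 = 2 |u|^2 - 2 <shift u, u> in each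
  direction. This turns the gradient into the Rayleigh quotient of \<open>avg\<close>.\<close>

lemma grad_norm_sq_eq:
  assumes "u \<in> l2_Z2"
  shows "grad_norm_sq u = 4 * ip u u - 4 * ip (avg u) u"
proof -
  have "D1 u = (\<lambda>p. shift (1,0) u p - 1 * u p)" "D2 u = (\<lambda>p. shift (0,1) u p - 1 * u p)"
    by (auto simp: D1_def D2_def shift_def)
  then show ?thesis
    using assms ip_diff_self[OF shift_l2[OF assms] assms, of "(1,0)" 1]
      ip_diff_self[OF shift_l2[OF assms] assms, of "(0,1)" 1]
    by (simp add: grad_norm_sq_def l2_norm_sq ip_shift_self ip_avg_self)
      (simp add: field_simps)
qed

text \<open>Equality in \<open>abs_ip_avg_le\<close> forces \<open>u\<^sup>2\<close> to be constant along horizontal lines.\<close>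

lemma abs_ip_avg_less:
  assumes u: "u \<in> l2_Z2" and nz: "u \<noteq> (\<lambda>_. 0)"
  shows "\<bar>ip (avg u) u\<bar> < ip u u"
proof (rule ccontr)
  assume "\<not> ?thesis"
  then have "\<bar>ip (avg u) u\<bar> = ip u u"
    using abs_ip_avg_le[OF u] by simp
  \<comment> \<open>\<open>s\<close> is the sign of \<open>ip (avg u) u\<close>. The squared norms
    of shift u - s u in the two unit directions add up to 4 (|u|^2 - s <avg u, u>) = 0, so the
    horizontal one vanishes.\<close>
  then obtain s :: real where s: "s\<^sup>2 = 1" "s * ip (avg u) u = ip u u"
    by (metis abs_if mult_1 mult_minus1 power2_minus power_one)
  have *: "ip (\<lambda>p. shift e u p - s * u p) (\<lambda>p. shift e u p - s * u p)
      = 2 * ip u u - 2 * s * ip (shift e u) u" for e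
    using ip_diff_self[OF shift_l2[OF u] u] s by (simp add: ip_shift_self)
  have "ip (\<lambda>p. shift (1,0) u p - s * u p) (\<lambda>p. shift (1,0) u p - s * u p)
      \<le> 2 * ip u u - 2 * s * ip (shift (1,0) u) u + (2 * ip u u - 2 * s * ip (shift (0,1) u) u)"
    using ip_self_nonneg[of "\<lambda>p. shift (0,1) u p - s * u p"] by (simp only: *)
  also have "\<dots> = 4 * ip u u - 4 * (s * ip (avg u) u)"
    by (simp add: ip_avg_self[OF u] algebra_simps)
  finally have le: "ip (\<lambda>p. shift (1,0) u p - s * u p) (\<lambda>p. shift (1,0) u p - s * u p) \<le> 0"
    using s by simp
  have "(\<lambda>p. shift (1,0) u p - s * u p) \<in> l2_Z2"
    using l2_lin[OF shift_l2[OF u] u, of 1 _ "-s"] by simp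
  then have "shift (1,0) u p = s * u p" for p
    using ip_self_eq_0D[OF _ le, of p] by simp
  then have step: "(u (n + 1, m))\<^sup>2 = (u (n, m))\<^sup>2" for n m
    using s by (metis add.right_neutral add_Pair mult_1 power_mult_distrib shift_def)
  have const: "(u (n + int j, m))\<^sup>2 = (u (n, m))\<^sup>2" for n m j
  proof (induction j)
    case (Suc j)
    then show ?case using step[of "n + int j" m] by (simp add: add_ac)
  qed simp
  obtain n m where nm: "u (n, m) \<noteq> 0"
    using nz by (auto simp: fun_eq_iff)
  \<comment> \<open>\<open>K\<close> equal positive terms on one horizontal line exceed the
    convergent sum of all squares.\<close>
  obtain K :: nat where K: "real K * (u (n, m))\<^sup>2 > (\<Sum>\<^sub>\<infinity>p. (u p)\<^sup>2)"
    using reals_Archimedean3[of "(u (n, m))\<^sup>2"] nm by auto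
  let ?F = "(\<lambda>j. (n + int j, m)) ` {..<K}"
  have "inj_on (\<lambda>j. (n + int j, m)) {..<K}"
    by (auto simp: inj_on_def)
  then have "(\<Sum>p\<in>?F. (u p)\<^sup>2) = real K * (u (n, m))\<^sup>2"
    by (simp add: sum.reindex const)
  moreover have "(\<Sum>p\<in>?F. (u p)\<^sup>2) \<le> (\<Sum>\<^sub>\<infinity>p. (u p)\<^sup>2)"
    using u by (intro finite_sum_le_infsum) (auto simp: l2_Z2_def)
  ultimately show False
    using K by simp
qed

section \<open>The walk started at \<open>delta\<close> and its return probabilities\<close>

lemma delta_l2: "delta \<in> l2_Z2"
  unfolding l2_Z2_def mem_Collect_eq
  by (rule finite_nonzero_values_imp_summable_on)
    (auto intro: finite_subset[of _ "{(0,0)}"] simp: delta_def split: if_splits)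

lemma ip_delta: "ip delta f = f (0, 0)"
proof -
  have "ip delta f = (\<Sum>\<^sub>\<infinity>p\<in>{(0, 0)}. delta p * f p)"
    unfolding ip_def by (rule infsum_cong_neutral) (auto simp: delta_def)
  then show ?thesis by (simp add: delta_def)
qed

lemma walk_l2: "walk n \<in> l2_Z2"
  by (induction n) (auto simp: delta_l2 avg_l2)

text \<open>Self-adjointness moves the averages from the left factor to the right one by one, until
  \<open>delta\<close> evaluates at the origin.\<close>

lemma ip_walk: "ip (walk i) (walk j) = ret (i + j)"
proof (induction i arbitrary: j)
  case 0
  then show ?case by (simp add: ip_delta ret_def)
next
  case (Suc i)
  have "ip (walk (Suc i)) (walk j) = ip (walk i) (walk (Suc j))"
    by (simp add: ip_avg walk_l2)
  then show ?case using Suc[of "Suc j"] by simp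
qed

text \<open>The number of \<open>n\<close>-step paths with steps 1 and -1 on the integers from 0 to
  \<open>j\<close>, kept real-valued to avoid coercions.\<close>

primrec paths :: "nat \<Rightarrow> int \<Rightarrow> real" where
  "paths 0 j = (if j = 0 then 1 else 0)"
| "paths (Suc n) j = paths n (j - 1) + paths n (j + 1)"

text \<open>In the rotated coordinates \<open>a + b\<close>, \<open>a - b\<close> the planar simple random walk is a pair of
  independent walks on the line.\<close>

lemma walk_eq_paths: "walk n (a, b) = paths n (a + b) * paths n (a - b) / 4 ^ n"
proof (induction n arbitrary: a b)
  case 0
  then show ?case by (auto simp: delta_def)
next
  case (Suc n)
  then show ?case by (simp add: avg_def algebra_simps) (simp add: field_simps)
qed

lemma paths_eq_0: "j < - int n \<Longrightarrow> paths n j = 0"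
  by (induction n arbitrary: j) auto

text \<open>A path with \<open>i\<close> upward steps out of \<open>n\<close> ends at 2i - n. The
  recursion of \<open>paths\<close> is Pascal's rule; at \<open>i = 0\<close> the left neighbour is
  out of reach and \<open>paths_eq_0\<close> removes it.\<close>

lemma paths_eq_binomial: "paths n (2 * int i - int n) = real (n choose i)"
proof (induction n arbitrary: i)
  case 0
  then show ?case by auto
next
  case (Suc n)
  show ?case
  proof (cases i)
    case 0
    then show ?thesis using Suc[of 0] by (simp add: paths_eq_0)
  next
    case (Suc j)
    have "2 * int i - int (Suc n) - 1 = 2 * int j - int n"
      "2 * int i - int (Suc n) + 1 = 2 * int i - int n"
      by (simp_all add: Suc)
    then show ?thesis
      unfolding paths.simps by (simp only: Suc.IH) (simp add: Suc)
  qed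
qed

lemma paths_odd: "odd (int n + j) \<Longrightarrow> paths n j = 0"
  by (induction n arbitrary: j) auto

lemma ret_odd: "odd n \<Longrightarrow> ret n = 0"
  by (simp add: ret_def walk_eq_paths paths_odd)

lemma ret_even: "ret (2 * n) = (real ((2 * n) choose n) / 4 ^ n)\<^sup>2"
  using paths_eq_binomial[of "2 * n" n]
  by (simp add: ret_def walk_eq_paths power2_eq_square power_mult power_mult_distrib[symmetric])

lemma ret_0 [simp]: "ret 0 = 1"
  by (simp add: ret_def delta_def)

lemma ret_nonneg: "0 \<le> ret n"
  by (cases "even n") (auto simp: ret_odd ret_even elim!: evenE)

lemma ret_Suc: "ret (2 * Suc n) = ret (2 * n) * ((2 * real n + 1) / (2 * real n + 2))\<^sup>2"
proof -
  have "real ((2 * Suc n) choose Suc n) / 4 ^ Suc n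
      = real ((2 * n) choose n) / 4 ^ n * ((2 * real n + 1) / (2 * real n + 2))"
  proof -
    have "real ((2 * m) choose m) = fact (2 * m) / (fact m * fact m)" for m
      using binomial_fact[of m "2 * m", where 'a = real] by (simp add: mult_2)
    then show ?thesis
      by (simp only:) (simp add: divide_simps, simp add: algebra_simps)
  qed
  then show ?thesis
    unfolding ret_even by (simp only: power_mult_distrib)
qed

text \<open>By \<open>ret_Suc\<close>, passing from n to n + 1 multiplies the left side by (2n +
  1)(2n + 3) / (2n + 2)^2, the reciprocal of the next Wallis factor.\<close>

lemma wallis_ret: "(2 * real n + 1) * ret (2 * n) = 1 / (\<Prod>k=1..n. (4 * real k^2) / (4 * real k^2 - 1))"
proof (induction n)
  case 0
  then show ?case by simp
next
  case (Suc n)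
  have "(2 * real (Suc n) + 1) * ret (2 * Suc n)
      = (2 * real n + 1) * ret (2 * n) / ((4 * real (Suc n)^2) / (4 * real (Suc n)^2 - 1))"
    unfolding ret_Suc by (simp add: divide_simps) (simp add: power2_eq_square algebra_simps)
  then show ?case
    by (simp add: Suc)
qed

lemma tendsto_wallis_ret: "(\<lambda>n. (2 * real n + 1) * ret (2 * n)) \<longlonglongrightarrow> 2 / pi"
  using tendsto_divide[OF tendsto_const[of 1] wallis] by (simp add: wallis_ret)

text \<open>The sequence decreases, hence stays above its Wallis limit.\<close>

lemma two_div_pi_le_ret: "2 / pi \<le> (2 * real n + 1) * ret (2 * n)"
proof (rule decseq_ge[OF decseq_SucI tendsto_wallis_ret])
  fix n
  have "(2 * real (Suc n) + 1) * ((2 * real n + 1) / (2 * real n + 2))\<^sup>2 \<le> 2 * real n + 1"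
    by (simp add: power2_eq_square divide_simps) (simp add: algebra_simps)
  from mult_right_mono[OF this ret_nonneg[of "2 * n"]]
  show "(2 * real (Suc n) + 1) * ret (2 * Suc n) \<le> (2 * real n + 1) * ret (2 * n)"
    unfolding ret_Suc by (simp add: mult_ac)
qed

lemma ret_ge: "1 / (pi * real (Suc n)) \<le> ret (2 * n)"
proof -
  have "2 / pi \<le> (2 * real n + 2) * ret (2 * n)"
    using two_div_pi_le_ret[of n] ret_nonneg[of "2 * n"] by (simp add: algebra_simps)
  also have "\<dots> = 2 * (real (Suc n) * ret (2 * n))"
    by (simp add: algebra_simps)
  finally have "1 / pi \<le> real (Suc n) * ret (2 * n)"
    by simp
  then show ?thesis
    using divide_right_mono[of "1 / pi" "real (Suc n) * ret (2 * n)" "real (Suc n)"]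
    by (simp add: mult_ac)
qed

text \<open>Here n p_(2n) increases to its limit 1 / pi: the step reduces to (2n + 1)^2 >= 4n(n +
  1).\<close>

lemma ret_le:
  assumes n: "0 < n"
  shows "ret (2 * n) \<le> 1 / (pi * real n)"
proof -
  have "(\<lambda>n. real n / (2 * real n + 1)) \<longlonglongrightarrow> 1 / 2"
    by real_asymp
  from tendsto_mult[OF this tendsto_wallis_ret]
  have "(\<lambda>n. real n * ret (2 * n)) \<longlonglongrightarrow> 1 / pi"
    by simp
  moreover have "incseq (\<lambda>n. real n * ret (2 * n))"
  proof (rule incseq_SucI)
    fix n
    have "real n \<le> real (Suc n) * ((2 * real n + 1) / (2 * real n + 2))\<^sup>2"
      by (simp add: power2_eq_square divide_simps) (simp add: algebra_simps)
    from mult_right_mono[OF this ret_nonneg[of "2 * n"]]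
    show "real n * ret (2 * n) \<le> real (Suc n) * ret (2 * Suc n)"
      unfolding ret_Suc by (simp add: mult_ac)
  qed
  ultimately have "real n * ret (2 * n) \<le> 1 / pi"
    using incseq_le by blast
  then show ?thesis
    using n by (simp add: field_simps)
qed

text \<open>A cruder bound that covers odd times and time 0 uniformly. At even times it holds
  because (2m + 1) p_(2m) decreases from the value 1.\<close>

lemma ret_le_inverse: "ret n \<le> 1 / real (Suc n)"
proof (cases "even n")
  case True
  then obtain m where m: "n = 2 * m" by (auto elim: evenE)
  have "(2 * real m + 1) * ret (2 * m) \<le> 1"
  proof (induction m)
    case 0
    then show ?case by simp
  next
    case (Suc m)
    have "(2 * real (Suc m) + 1) * ((2 * real m + 1) / (2 * real m + 2))\<^sup>2 \<le> 2 * real m + 1"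
      by (simp add: power2_eq_square divide_simps) (simp add: algebra_simps)
    from mult_right_mono[OF this ret_nonneg[of "2 * m"]] Suc
    show ?case unfolding ret_Suc by (simp add: mult_ac)
  qed
  then show ?thesis by (simp add: m field_simps)
qed (simp add: ret_odd)

section \<open>Bounding the value at the origin by the quadratic form\<close>

lemma avg_form_diff:
  assumes u: "u \<in> l2_Z2" and v: "v \<in> l2_Z2" and k: "\<bar>k\<bar> \<le> 1"
  shows "0 \<le> (ip u u - k * ip (avg u) u) - 2 * t * (ip v u - k * ip (avg v) u)
    + t\<^sup>2 * (ip v v - k * ip (avg v) v)"
proof -
  let ?w = "\<lambda>p. u p - t * v p"
  have "avg ?w = (\<lambda>p. avg u p - t * avg v p)"
    by (auto simp: avg_def diff_divide_distrib algebra_simps)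
  then have "ip (avg ?w) ?w = ip (avg u) u - 2 * t * ip (avg v) u + t\<^sup>2 * ip (avg v) v"
    using ip_diff[OF avg_l2 avg_l2 u v, OF u v] ip_commute[of u "avg v"] ip_avg[OF u v] by simp
  moreover have "ip ?w ?w = ip u u - 2 * t * ip v u + t\<^sup>2 * ip v v"
    using ip_diff_self[OF u v, of t] ip_commute[of u v] by simp
  moreover have "?w \<in> l2_Z2"
    using l2_lin[OF u v, of 1 "-t"] by simp
  from avg_form_nonneg[OF this k] have "0 \<le> ip ?w ?w - k * ip (avg ?w) ?w" .
  ultimately have "0 \<le> ip u u - 2 * t * ip v u + t\<^sup>2 * ip v v
      - k * (ip (avg u) u - 2 * t * ip (avg v) u + t\<^sup>2 * ip (avg v) v)"
    by (simp only:)
  then show ?thesis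
    by (simp add: algebra_simps)
qed

text \<open>Applying 1 - k P to the truncated Neumann series telescopes to \<open>delta\<close>
  minus k^N times \<open>walk N\<close>.\<close>

lemma sum_walk_form:
  fixes k :: real and N :: nat
  defines "v \<equiv> (\<lambda>p. \<Sum>n<N. k ^ n * walk n p)"
  assumes u: "u \<in> l2_Z2"
  shows "ip v u - k * ip (avg v) u = u (0, 0) - k ^ N * ip (walk N) u"
proof -
  have v: "v \<in> l2_Z2"
    unfolding v_def by (rule sum_l2) (rule walk_l2)
  have *: "ip v g = (\<Sum>n<N. k ^ n * ip (walk n) g)" if "g \<in> l2_Z2" for g
    unfolding v_def using that by (intro ip_sum walk_l2) auto
  have "ip (avg v) u = (\<Sum>n<N. k ^ n * ip (walk (Suc n)) u)"
    by (simp add: ip_avg v u * avg_l2 walk_l2)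
  then have "ip v u - k * ip (avg v) u
      = (\<Sum>n<N. k ^ n * ip (walk n) u - k ^ Suc n * ip (walk (Suc n)) u)"
    by (simp only: *[OF u]) (simp add: sum_subtractf sum_distrib_left mult_ac)
  also have "\<dots> = u (0, 0) - k ^ N * ip (walk N) u"
    by (subst sum_lessThan_telescope') (simp add: ip_delta)
  finally show ?thesis .
qed

text \<open>Negative \<open>k\<close> is harmless, since the walk cannot return at odd
  times.\<close>

lemma power_ret_nonneg: "0 \<le> (k::real) ^ n * ret n"
  by (cases "even n") (auto simp: ret_odd ret_nonneg zero_le_even_power)

lemma sum_ret_even: "(\<Sum>m<2 * N. (k::real) ^ m * ret m) = (\<Sum>n<N. (k\<^sup>2) ^ n * ret (2 * n))"
  by (induction N) (simp_all add: ret_odd power_mult)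

text \<open>The term at \<open>n = 0\<close> is a division by zero and so equals 0, which lets the
  sum start at 0 and still be a partial sum of the logarithm series.\<close>

lemma sum_power_div_le_ln:
  assumes "0 \<le> z" "z < (1::real)"
  shows "(\<Sum>n<N. z ^ n / real n) \<le> - ln (1 - z)"
proof -
  have "(\<lambda>n. - (- (z ^ n) / real n)) sums - ln (1 - z)"
    using ln_series'[of "-z"] assms by (intro sums_minus) simp
  then have "(\<lambda>n. z ^ n / real n) sums - ln (1 - z)"
    by simp
  then show ?thesis
    using sum_le_suminf[of "\<lambda>n. z ^ n / real n" "{..<N}"] assms
    by (auto simp: sums_iff)
qed

lemma sum_power_ret_le:
  assumes "\<bar>k\<bar> < (1::real)"
  shows "(\<Sum>m<N. k ^ m * ret m) \<le> 1 - ln (1 - k\<^sup>2) / pi"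
proof -
  have k: "0 \<le> k\<^sup>2" "k\<^sup>2 < 1"
    using assms by (auto simp: abs_square_less_1)
  \<comment> \<open>Passing to an even number of nonnegative terms prepares the restriction to even
    times. \<open>Suc N\<close> puts the time-0 term, which is the leading 1 below, into the base
    case of the induction.\<close>
  have "(\<Sum>m<N. k ^ m * ret m) \<le> (\<Sum>m<2 * Suc N. k ^ m * ret m)"
    by (intro sum_mono2) (auto simp: power_ret_nonneg)
  also have "\<dots> = (\<Sum>n<Suc N. (k\<^sup>2) ^ n * ret (2 * n))"
    by (rule sum_ret_even)
  also have "\<dots> \<le> 1 + (\<Sum>n<Suc N. (k\<^sup>2) ^ n / real n) / pi"
  proof (induction N)
    case (Suc N)
    have "(k\<^sup>2) ^ Suc N * ret (2 * Suc N) \<le> (k\<^sup>2) ^ Suc N * (1 / (pi * real (Suc N)))"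
      using ret_le[of "Suc N"] k by (intro mult_left_mono) auto
    also have "\<dots> = (k\<^sup>2) ^ Suc N / real (Suc N) / pi"
      by simp
    finally show ?case
      using Suc unfolding sum.lessThan_Suc[of _ "Suc N"] add_divide_distrib by linarith
  qed simp
  also have "\<dots> \<le> 1 + (- ln (1 - k\<^sup>2)) / pi"
    using sum_power_div_le_ln[OF k, of "Suc N"] pi_ge_zero by (intro add_left_mono divide_right_mono)
  finally show ?thesis by simp
qed

text \<open>Truncated resolvents keep every inner product a finite sum; the truncation error is of
  order |k|^N and vanishes in the limit.\<close>

lemma value_at_0_bound:
  assumes u: "u \<in> l2_Z2" and k: "\<bar>k\<bar> < 1"
  shows "(u (0, 0))\<^sup>2 \<le> (ip u u - k * ip (avg u) u) * (1 - ln (1 - k\<^sup>2) / pi)"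
proof -
  define B where "B = 1 - ln (1 - k\<^sup>2) / pi"
  define Q where "Q = ip u u - k * ip (avg u) u"
  have "B \<ge> 1"
    using k by (simp add: B_def abs_square_less_1 divide_nonpos_pos)
  have le: "(u (0, 0) - k ^ N * ip (walk N) u)\<^sup>2 \<le> Q * B" for N
  proof -
    define v where "v = (\<lambda>p. \<Sum>n<N. k ^ n * walk n p)"
    define b where "b = u (0, 0) - k ^ N * ip (walk N) u"
    have v: "v \<in> l2_Z2"
      unfolding v_def by (rule sum_l2) (rule walk_l2)
    have "ip v v - k * ip (avg v) v = v (0, 0) - k ^ N * ip v (walk N)"
      using sum_walk_form[OF v[unfolded v_def]] by (simp add: v_def ip_commute[of "walk N"])
    also have "ip v (walk N) = (\<Sum>n<N. k ^ n * ret (n + N))"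
      unfolding v_def by (subst ip_sum) (auto simp: walk_l2 ip_walk)
    also have "k ^ N * \<dots> = (\<Sum>n<N. k ^ (n + N) * ret (n + N))"
      by (simp add: sum_distrib_left power_add mult_ac)
    finally have "ip v v - k * ip (avg v) v \<le> v (0, 0)"
      by (simp add: sum_nonneg power_ret_nonneg)
    also have "\<dots> \<le> B"
      using sum_power_ret_le[OF k] by (simp add: v_def B_def ret_def)
    finally have "(b / B)\<^sup>2 * (ip v v - k * ip (avg v) v) \<le> (b / B)\<^sup>2 * B"
      by (intro mult_left_mono) auto
    \<comment> \<open>The parameter b / B minimizes Q - 2 t b + t^2 B over t, with minimum Q - b^2 /
      B; its nonnegativity is the Cauchy-Schwarz bound.\<close>
    moreover have "0 \<le> Q - 2 * (b / B) * b + (b / B)\<^sup>2 * (ip v v - k * ip (avg v) v)"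
      using avg_form_diff[OF u v, of k "b / B"] k sum_walk_form[OF u, of k N]
      by (simp add: Q_def b_def v_def)
    ultimately have "0 \<le> Q - 2 * (b / B) * b + (b / B)\<^sup>2 * B"
      by linarith
    also have "\<dots> = Q - b\<^sup>2 / B"
      using \<open>B \<ge> 1\<close> by (simp add: power2_eq_square field_simps)
    finally show ?thesis
      using \<open>B \<ge> 1\<close> by (simp add: b_def field_simps)
  qed
  \<comment> \<open>The squared norm of \<open>walk N\<close> is \<open>ret (N + N)\<close>, at most
    1, so the inner products with \<open>u\<close> are bounded in \<open>N\<close>.\<close>
  have "(\<lambda>N. k ^ N * ip (walk N) u) \<longlonglongrightarrow> 0"
  proof (rule Lim_null_comparison)
    have "norm (k ^ N * ip (walk N) u) \<le> \<bar>k\<bar> ^ N * ((1 + ip u u) / 2)" for N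
    proof -
      have "ret (N + N) \<le> 1 / real (Suc (N + N))"
        by (rule ret_le_inverse)
      also have "\<dots> \<le> 1"
        by simp
      finally have "\<bar>ip (walk N) u\<bar> \<le> (1 + ip u u) / 2"
        using abs_ip_le[OF walk_l2 u, of N] by (simp add: ip_walk)
      then show ?thesis
        unfolding real_norm_def abs_mult power_abs by (intro mult_left_mono) auto
    qed
    then show "\<forall>\<^sub>F N in sequentially. norm (k ^ N * ip (walk N) u) \<le> \<bar>k\<bar> ^ N * ((1 + ip u u) / 2)"
      by simp
    show "(\<lambda>N. \<bar>k\<bar> ^ N * ((1 + ip u u) / 2)) \<longlonglongrightarrow> 0"
      using k by (intro tendsto_mult_left_zero LIMSEQ_power_zero) simp
  qed
  then have "(\<lambda>N. (u (0, 0) - k ^ N * ip (walk N) u)\<^sup>2) \<longlonglongrightarrow> (u (0, 0) - 0)\<^sup>2"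
    by (intro tendsto_intros)
  then have "(u (0, 0) - 0)\<^sup>2 \<le> Q * B"
    by (rule LIMSEQ_le_const2) (use le in auto)
  then show ?thesis
    by (simp add: Q_def B_def)
qed

section \<open>Elementary optimization of the resolvent parameter\<close>

text \<open>The choice \<open>1 - k\<^sup>2 = (1 - r\<^sup>2) / (1 + L)\<close> with \<open>L = - ln (1 - r\<^sup>2)\<close> reproduces the exact
  argument \<open>L + ln (1 + L)\<close> of the right-hand side; it is optimal to leading order as
  \<open>\<bar>r\<bar> \<rightarrow> 1\<close>.\<close>

lemma parameter_choice:
  fixes r :: real
  defines "L \<equiv> - ln (1 - r\<^sup>2)"
  assumes r: "\<bar>r\<bar> < 1" "r \<noteq> 0"
  obtains k where "\<bar>k\<bar> < 1"
    "(1 - k * r) * (1 - ln (1 - k\<^sup>2) / pi) < (1 - r\<^sup>2) * (1 + (L + ln (1 + L)) / (2 * pi))"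
proof -
  define q where "q = 1 - r\<^sup>2"
  have q: "0 < q" "q < 1"
    using r by (auto simp: q_def abs_square_less_1)
  have L: "L > 0" "q = exp (- L)"
    using q by (simp_all add: L_def q_def[symmetric] ln_less_zero)
  define b where "b = 1 / (1 + L)"
  have b: "0 < b" "b < 1"
    using L by (auto simp: b_def)
  define s where "s = (L + ln (1 + L)) / pi"
  have lnL: "0 \<le> ln (1 + L)" "ln (1 + L) \<le> L"
    using L by (auto intro: ln_add_one_self_le_self)
  have s: "L / pi \<le> s" "s \<le> 2 * L / pi"
    using lnL by (auto simp: s_def intro!: divide_right_mono)
  have s1: "s > 0" "s \<le> 2 / 3 * L"
  proof -
    show "s > 0"
      using s(1) L by (smt (verit) divide_pos_pos pi_gt_zero)
    have "2 * L / pi \<le> 2 * L / 3"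
      using L pi_gt3 by (intro divide_left_mono) auto
    then show "s \<le> 2 / 3 * L"
      using s by simp
  qed
  \<comment> \<open>With q = 1 - r^2 the goal reads (1 - k r)(1 + s) < q (1 + s / 2), that is, k r >
    1 - q \<rho>.\<close>
  define \<rho> where "\<rho> = (1 + s / 2) / (1 + s)"
  have qb: "q \<le> b"
  proof -
    have "1 + L \<le> exp L" by (rule exp_ge_add_one_self)
    then have "inverse (exp L) \<le> inverse (1 + L)"
      using L by (intro le_imp_inverse_le) auto
    then show ?thesis
      by (simp add: L(2) b_def exp_minus inverse_eq_divide)
  qed
  \<comment> \<open>Giving \<open>k\<close> the sign of \<open>r\<close> makes k r nonnegative, so
    the goal can be squared.\<close>
  define k where "k = sgn r * sqrt (1 - q * b)"
  have qb1: "q * b < 1" "q * b > 0"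
    using q b mult_strict_mono[of q 1 b 1] by auto
  have k2: "k\<^sup>2 = 1 - q * b"
    using r qb1 by (simp add: k_def power_mult_distrib sgn_if)
  have kr: "k * r = sqrt ((1 - q) * (1 - q * b))"
  proof -
    have "sqrt (1 - q) = \<bar>r\<bar>"
      by (simp add: q_def)
    then have "sqrt ((1 - q) * (1 - q * b)) = \<bar>r\<bar> * sqrt (1 - q * b)"
      by (simp add: real_sqrt_mult)
    then show ?thesis
      by (simp add: k_def sgn_if)
  qed
  have "ln (1 - k\<^sup>2) = - (L + ln (1 + L))"
    using L b by (simp add: k2 ln_mult) (simp add: b_def ln_div)
  then have B: "1 - ln (1 - k\<^sup>2) / pi = 1 + s"
    by (simp add: s_def field_simps)
  define a where "a = 1 / (1 + s)"
  have rho2: "2 * \<rho> - 1 = a" "\<rho>\<^sup>2 = a + s\<^sup>2 * a\<^sup>2 / 4"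
    using s1 by (simp_all add: \<rho>_def a_def power2_eq_square divide_simps) (simp_all add: algebra_simps)
  \<comment> \<open>This is (1 - q \<rho>)^2 < (1 - q)(1 - q b) after expanding and cancelling a
    factor q, with 2 \<rho> - 1 = a.\<close>
  have "q * (\<rho>\<^sup>2 - b) < a - b"
  proof -
    \<comment> \<open>The case q = b with denominators cleared; \<open>s \<le> 2 / 3 * L\<close>
      leaves L - s at least L / 3.\<close>
    have "s * s * (1 + L) < 4 * (L - s) * L * (1 + s)"
    proof -
      have ss: "s * s \<le> 2 / 3 * L * s" "s * s \<le> (2 / 3 * L) * (2 / 3 * L)"
        using s1 L by (intro mult_right_mono mult_mono; simp)+
      have "s * s * (1 + L) = s * s + s * s * L"
        by (simp add: algebra_simps)
      also have "\<dots> \<le> (2 / 3 * L) * (2 / 3 * L) + 2 / 3 * L * s * L"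
        using ss L by (intro add_mono mult_right_mono[OF ss(1)]) auto
      also have "\<dots> < 4 * (L / 3) * L * (1 + s)"
        using s1 L by (simp add: algebra_simps add_pos_pos)
      also have "\<dots> \<le> 4 * (L - s) * L * (1 + s)"
        using s1 L by (intro mult_right_mono mult_left_mono) auto
      finally show ?thesis .
    qed
    then have "b * (s\<^sup>2 * a\<^sup>2 / 4) < (a - b) * (1 - b)"
      using s1 L by (simp add: a_def b_def power2_eq_square divide_simps) (simp add: algebra_simps)
    then have *: "b * (\<rho>\<^sup>2 - b) < a - b"
      by (simp add: rho2 algebra_simps)
    have "a > b"
      using s1 L by (simp add: a_def b_def frac_less2)
    \<comment> \<open>If \<rho>^2 - b is nonnegative, q may be raised to b; otherwise the left side
      is at most 0 and a > b suffices.\<close>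
    show ?thesis
    proof (cases "\<rho>\<^sup>2 - b \<ge> 0")
      case True
      then show ?thesis
        using * mult_right_mono[OF qb True] by linarith
    next
      case False
      then have "q * (\<rho>\<^sup>2 - b) \<le> 0"
        using q by (simp add: mult_le_0_iff)
      then show ?thesis
        using \<open>a > b\<close> by linarith
    qed
  qed
  then have "q * (q * (\<rho>\<^sup>2 - b)) < q * (2 * \<rho> - 1 - b)"
    using q rho2 by (intro mult_strict_left_mono) auto
  then have "(1 - q * \<rho>)\<^sup>2 < (1 - q) * (1 - q * b)"
    by (simp add: power2_eq_square algebra_simps)
  then have "1 - q * \<rho> < k * r"
    unfolding kr by (rule real_less_rsqrt)
  then have "(1 - k * r) * (1 + s) < q * \<rho> * (1 + s)"
    using s1 by (intro mult_strict_right_mono) auto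
  also have "\<dots> = q * (1 + s / 2)"
    using s1 by (simp add: \<rho>_def)
  finally have "(1 - k * r) * (1 - ln (1 - k\<^sup>2) / pi) < (1 - r\<^sup>2) * (1 + (L + ln (1 + L)) / (2 * pi))"
    by (simp add: B q_def s_def mult.commute)
  moreover have "\<bar>k\<bar> < 1"
    using qb1 k2 by (simp flip: abs_square_less_1)
  ultimately show ?thesis
    using that by blast
qed

section \<open>The inequality in terms of Rayleigh quotients, and equality at
  \<open>delta\<close>\<close>

lemma log_bound_eq:
  assumes "\<bar>r\<bar> < 1"
  shows "log_bound a b c (4 - 4 * r)
    = (1 - r\<^sup>2) * (a * - ln (1 - r\<^sup>2) + b * ln (1 + - ln (1 - r\<^sup>2)) + c) / (2 * pi)"
proof -
  have "16 / ((4 - 4 * r) * (8 - (4 - 4 * r))) = 16 / (16 * (1 - r\<^sup>2))"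
    by (simp add: power2_eq_square algebra_simps)
  also have "\<dots> = 1 / (1 - r\<^sup>2)"
    by (simp only: divide_divide_eq_left[symmetric])
  finally have "ln (16 / ((4 - 4 * r) * (8 - (4 - 4 * r)))) = - ln (1 - r\<^sup>2)"
    using assms by (simp add: ln_div abs_square_less_1)
  moreover have "1 / (4 * pi) * (4 - 4 * r) * (1 - (4 - 4 * r) / 8) = (1 - r\<^sup>2) / (2 * pi)"
    by (simp add: power2_eq_square field_simps)
  ultimately show ?thesis
    unfolding log_bound_def by simp
qed

lemma rayleigh_quotient:
  assumes u: "u \<in> l2_Z2" and nz: "u \<noteq> (\<lambda>_. 0)"
  obtains r where "\<bar>r\<bar> < 1" "ip (avg u) u = r * ip u u" "0 < ip u u"
    "grad_norm_sq u / (l2_norm u)\<^sup>2 = 4 - 4 * r"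
proof
  have less: "\<bar>ip (avg u) u\<bar> < ip u u"
    by (rule abs_ip_avg_less[OF u nz])
  then show "0 < ip u u" by linarith
  then show "\<bar>ip (avg u) u / ip u u\<bar> < 1" "ip (avg u) u = ip (avg u) u / ip u u * ip u u"
    "grad_norm_sq u / (l2_norm u)\<^sup>2 = 4 - 4 * (ip (avg u) u / ip u u)"
    using less by (simp_all add: grad_norm_sq_eq[OF u] l2_norm_sq diff_divide_distrib)
qed

text \<open>For r = 0 the right side is 1, and strictness comes from the nonzero component of
  \<open>u\<close> orthogonal to \<open>delta\<close>. For other r the parameter choice is already
  strict.\<close>

lemma strict_bound:
  assumes u: "u \<in> l2_Z2" and nz: "u \<noteq> (\<lambda>_. 0)" and nd: "\<nexists>k. u = (\<lambda>p. k * delta p)"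
  shows "(u (0, 0))\<^sup>2 / (l2_norm u)\<^sup>2 < log_bound 1 1 (2 * pi) (grad_norm_sq u / (l2_norm u)\<^sup>2)"
proof -
  obtain r where r: "\<bar>r\<bar> < 1" "ip (avg u) u = r * ip u u" "0 < ip u u"
    "grad_norm_sq u / (l2_norm u)\<^sup>2 = 4 - 4 * r"
    using rayleigh_quotient[OF u nz] .
  show ?thesis
  proof (cases "r = 0")
    case True
    have "\<not> ip (\<lambda>p. u p - u (0,0) * delta p) (\<lambda>p. u p - u (0,0) * delta p) \<le> 0"
    proof
      assume le: "ip (\<lambda>p. u p - u (0,0) * delta p) (\<lambda>p. u p - u (0,0) * delta p) \<le> 0"
      have l2: "(\<lambda>p. u p - u (0,0) * delta p) \<in> l2_Z2"
        using l2_lin[OF u delta_l2, of 1 "- u (0,0)"] by simp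
      have "u p = u (0,0) * delta p" for p
        using ip_self_eq_0D[OF l2 le, of p] by linarith
      then have "u = (\<lambda>p. u (0,0) * delta p)"
        by (rule ext)
      with nd show False by blast
    qed
    then have "(u (0,0))\<^sup>2 < ip u u"
      using ip_commute[of u delta]
      by (simp add: ip_diff_self u delta_l2 ip_delta) (simp add: delta_def power2_eq_square)
    then show ?thesis
      using r(3) unfolding r(4) log_bound_eq[OF r(1)] unfolding l2_norm_sq True by simp
  next
    case False
    define L where "L = - ln (1 - r\<^sup>2)"
    obtain k where k: "\<bar>k\<bar> < 1"
      "(1 - k * r) * (1 - ln (1 - k\<^sup>2) / pi) < (1 - r\<^sup>2) * (1 + (L + ln (1 + L)) / (2 * pi))"
      using parameter_choice[OF r(1) False] unfolding L_def by blast
    have "(u (0,0))\<^sup>2 \<le> (ip u u - k * (r * ip u u)) * (1 - ln (1 - k\<^sup>2) / pi)"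
      using value_at_0_bound[OF u k(1)] by (simp only: r(2))
    also have "ip u u - k * (r * ip u u) = (1 - k * r) * ip u u"
      by (simp add: algebra_simps)
    also have "\<dots> * (1 - ln (1 - k\<^sup>2) / pi) = (1 - k * r) * (1 - ln (1 - k\<^sup>2) / pi) * ip u u"
      by (simp only: mult_ac)
    also have "\<dots> < ((1 - r\<^sup>2) * (1 + (L + ln (1 + L)) / (2 * pi))) * ip u u"
      using k(2) r(3) by (rule mult_strict_right_mono)
    also have "(1 - r\<^sup>2) * (1 + (L + ln (1 + L)) / (2 * pi)) = log_bound 1 1 (2 * pi) (4 - 4 * r)"
      unfolding log_bound_eq[OF r(1)] by (simp add: L_def divide_simps)
    finally show ?thesis
      unfolding r(4) unfolding l2_norm_sq using r(3) by (simp add: divide_less_eq)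
  qed
qed

lemma delta_equality:
  assumes "k \<noteq> 0" "u = (\<lambda>p. k * delta p)"
  shows "u \<in> l2_Z2" "(u (0, 0))\<^sup>2 / (l2_norm u)\<^sup>2
    = log_bound 1 1 (2 * pi) (grad_norm_sq u / (l2_norm u)\<^sup>2)"
proof -
  \<comment> \<open>Written as a one-term sum of walks so that \<open>sum_l2\<close> and
    \<open>ip_sum\<close> apply.\<close>
  have u: "u = (\<lambda>p. \<Sum>n<Suc 0. k * walk n p)"
    by (simp add: assms)
  then show l2: "u \<in> l2_Z2"
    by (simp only:) (rule sum_l2, rule walk_l2)
  have *: "ip u g = k * ip delta g" if "g \<in> l2_Z2" for g
    unfolding u using that by (subst ip_sum) (auto simp: delta_l2)
  have "ip u u = k * k"
    using *[OF l2] by (simp add: ip_delta) (simp add: assms delta_def)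
  moreover have "ip (avg u) u = 0"
    using *[OF avg_l2[OF l2]] by (simp add: ip_avg l2 ip_delta) (simp add: assms avg_def delta_def)
  ultimately have "grad_norm_sq u / (l2_norm u)\<^sup>2 = 4 - 4 * 0" "(u (0, 0))\<^sup>2 / (l2_norm u)\<^sup>2 = 1"
    using assms(1) by (simp_all add: grad_norm_sq_eq l2 l2_norm_sq)
      (simp add: assms(2) delta_def power2_eq_square)
  then show "(u (0, 0))\<^sup>2 / (l2_norm u)\<^sup>2
      = log_bound 1 1 (2 * pi) (grad_norm_sq u / (l2_norm u)\<^sup>2)"
    by (simp only: log_bound_eq) simp
qed

section \<open>Sharpness of the three constants\<close>

lemma double_sum_ret_le: "(\<Sum>i<N. \<Sum>j<N. ret (i + j)) \<le> 2 * real N"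
proof (induction N)
  case (Suc N)
  \<comment> \<open>The new row and column have at most N + 1 entries each, all bounded by 1 / (N +
    1), so each step adds at most 2.\<close>
  have le: "ret m \<le> 1 / real (Suc N)" if "N \<le> m" for m
    using order_trans[OF ret_le_inverse[of m] divide_left_mono] that by simp
  have "(\<Sum>j<Suc N. ret (N + j)) \<le> (\<Sum>j<Suc N. 1 / real (Suc N))"
    by (intro sum_mono le) simp
  moreover have "(\<Sum>i<N. ret (i + N)) \<le> (\<Sum>i<N. 1 / real (Suc N))"
    by (intro sum_mono le) simp
  moreover have "(\<Sum>i<N. 1 / real (Suc N)) \<le> 1"
    by simp
  moreover have "(\<Sum>j<Suc N. 1 / real (Suc N)) = 1"
    by simp
  ultimately have "(\<Sum>j<Suc N. ret (N + j)) \<le> 1" "(\<Sum>i<N. ret (i + N)) \<le> 1"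
    by linarith+
  moreover have "(\<Sum>i<Suc N. \<Sum>j<Suc N. ret (i + j))
      = (\<Sum>i<N. \<Sum>j<N. ret (i + j)) + (\<Sum>i<N. ret (i + N)) + (\<Sum>j<Suc N. ret (N + j))"
    by (simp add: sum.distrib)
  ultimately show ?case
    using Suc by simp
qed simp

text \<open>The Green sum v over 2M times has (1 - r) |v|^2 = v(0,0) - tail with tail in [0,1].
  Dropping the tail bounds v(0,0)^2 / |v|^2 below; v(0,0) >= ln (M + 1) / pi and |v|^2 <= 4M bound 1
  - r below. The assumption on \<open>M\<close> makes v(0,0) > 1.\<close>

lemma near_extremal:
  assumes M: "pi < ln (real M + 1)"
  obtains u r where "u \<in> l2_Z2" "u \<noteq> (\<lambda>_. 0)" "0 \<le> r" "r < 1"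
    "grad_norm_sq u / (l2_norm u)\<^sup>2 = 4 - 4 * r"
    "ln (real M + 1) / pi * (1 - r) \<le> (u (0, 0))\<^sup>2 / (l2_norm u)\<^sup>2"
    "(ln (real M + 1) / pi - 1) / (4 * real M) \<le> 1 - r"
proof -
  define N where "N = 2 * M"
  define T where "T = ln (real M + 1)"
  \<comment> \<open>The factor \<open>1 ^ n\<close> keeps the shape of \<open>sum_walk_form\<close>
    at k = 1.\<close>
  define v where "v = (\<lambda>p. \<Sum>n<N. 1 ^ n * walk n p)"
  have v: "v \<in> l2_Z2"
    unfolding v_def by (rule sum_l2) (rule walk_l2)
  have *: "ip v g = (\<Sum>n<N. ip (walk n) g)" if "g \<in> l2_Z2" for g
    unfolding v_def using that by (subst ip_sum) (auto simp: walk_l2)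
  have walk_v: "ip (walk n) v = (\<Sum>m<N. ret (n + m))" for n
    using *[OF walk_l2, of n] by (simp add: ip_commute[of "walk n" v] ip_walk add.commute)
  have E_le: "ip v v \<le> 4 * real M"
    using double_sum_ret_le[of N] by (simp add: * v walk_v N_def)
  have avg_nonneg: "0 \<le> ip (avg v) v"
  proof -
    have "ip (avg v) v = (\<Sum>n<N. ip (walk (Suc n)) v)"
      by (simp add: ip_avg v * avg_l2 walk_l2)
    then show ?thesis
      by (simp only: walk_v) (simp add: sum_nonneg ret_nonneg)
  qed
  have v0: "T / pi \<le> v (0, 0)"
  proof -
    have "v (0, 0) = (\<Sum>n<M. ret (2 * n))"
      using sum_ret_even[of 1 M] by (simp add: v_def N_def ret_def)
    also have "\<dots> \<ge> (\<Sum>n<M. 1 / (pi * real (Suc n)))"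
      by (intro sum_mono ret_ge)
    also have "(\<Sum>n<M. 1 / (pi * real (Suc n))) = harm M / pi"
      by (simp add: harm_def sum.atLeast1_atMost_eq sum_divide_distrib inverse_eq_divide mult.commute)
    finally show ?thesis
      using harm_ge_ln[of M] divide_right_mono[of T "harm M" pi] by (simp add: T_def)
  qed
  then have v0_gt: "1 < v (0, 0)"
    using M by (simp add: T_def less_le_trans[of 1 "T / pi"])
  then have nz: "v \<noteq> (\<lambda>_. 0)"
    by auto
  obtain r where r: "\<bar>r\<bar> < 1" "ip (avg v) v = r * ip v v" "0 < ip v v"
    "grad_norm_sq v / (l2_norm v)\<^sup>2 = 4 - 4 * r"
    using rayleigh_quotient[OF v nz] .
  have form: "(1 - r) * ip v v = v (0, 0) - ip (walk N) v"
  proof -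
    have "ip v v - 1 * ip (avg v) v = v (0, 0) - 1 ^ N * ip (walk N) v"
      using sum_walk_form[OF v[unfolded v_def], of 1 N] unfolding v_def .
    then show ?thesis
      using r(2) by (simp add: algebra_simps)
  qed
  have "ip (walk N) v \<le> (\<Sum>m<N. 1 / real (Suc N))"
    unfolding walk_v
  proof (rule sum_mono)
    fix m
    show "ret (N + m) \<le> 1 / real (Suc N)"
      by (rule order_trans[OF ret_le_inverse divide_left_mono]) simp_all
  qed
  also have "\<dots> \<le> 1"
    by simp
  finally have R: "0 \<le> ip (walk N) v" "ip (walk N) v \<le> 1"
    by (simp_all add: walk_v sum_nonneg ret_nonneg)
  show ?thesis
  proof (rule that[OF v nz _ _ r(4)])
    show "0 \<le> r"
      using avg_nonneg r(2,3) by (simp add: zero_le_mult_iff)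
    show "r < 1"
      using r(1) by simp
    have "T / pi * ((1 - r) * ip v v) \<le> v (0, 0) * v (0, 0)"
      using v0 v0_gt R r(1,3) by (intro mult_mono) (auto simp: form)
    then have "T / pi * (1 - r) * ip v v \<le> (v (0, 0))\<^sup>2"
      by (simp add: power2_eq_square mult_ac)
    then show "ln (real M + 1) / pi * (1 - r) \<le> (v (0, 0))\<^sup>2 / (l2_norm v)\<^sup>2"
      using r(3) unfolding l2_norm_sq T_def by (simp only: pos_le_divide_eq)
    have "T / pi - 1 \<le> (1 - r) * ip v v"
      using v0 R form by linarith
    also have "\<dots> \<le> (1 - r) * (4 * real M)"
      using E_le r(1) by (intro mult_left_mono) auto
    finally show "(ln (real M + 1) / pi - 1) / (4 * real M) \<le> 1 - r"
      using r(1,3) E_le by (simp add: T_def divide_le_eq)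
  qed
qed

text \<open>Evaluates a supposed inequality at the near-extremal sequence, with L = - ln (1 - r^2).
  The bound on L with the term - ln T detects the coefficient of the iterated logarithm; the cruder
  \<open>L \<le> T\<close> suffices for the first one.\<close>

lemma ineq_holds_imp:
  assumes ineq: "ineq_holds a b c" and T: "T = ln (real M + 1)" "8 * pi \<le> T"
  obtains L where "0 \<le> L" "L \<le> T - ln T + ln (8 * pi)" "L \<le> T"
    "T \<le> a * L + b * ln (1 + L) + c"
proof -
  have T0: "T > 0" "pi < T"
    using T(2) pi_gt_zero by linarith+
  obtain u r where u: "u \<in> l2_Z2" "u \<noteq> (\<lambda>_. 0)" and r: "0 \<le> r" "r < 1"
    and x: "grad_norm_sq u / (l2_norm u)\<^sup>2 = 4 - 4 * r"
    and le: "ln (real M + 1) / pi * (1 - r) \<le> (u (0, 0))\<^sup>2 / (l2_norm u)\<^sup>2"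
    and ge: "(ln (real M + 1) / pi - 1) / (4 * real M) \<le> 1 - r"
    using near_extremal[OF T0(2)[unfolded T(1)]] .
  note le = le[folded T(1)] and ge = ge[folded T(1)]
  define L where "L = - ln (1 - r\<^sup>2)"
  define X where "X = a * L + b * ln (1 + L) + c"
  have r2: "1 - r \<le> 1 - r\<^sup>2" "1 - r\<^sup>2 \<le> 2 * (1 - r)" "r\<^sup>2 < 1"
  proof -
    have "0 \<le> r * (1 - r)" "0 \<le> (1 - r) * (1 - r)"
      using r by simp_all
    then show "1 - r \<le> 1 - r\<^sup>2" "1 - r\<^sup>2 \<le> 2 * (1 - r)"
      by (simp_all add: power2_eq_square algebra_simps)
    show "r\<^sup>2 < 1"
      using r by (simp add: abs_square_less_1)
  qed
  have "T / pi * (1 - r) \<le> (1 - r\<^sup>2) * X / (2 * pi)"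
  proof -
    have "(u (0, 0))\<^sup>2 / (l2_norm u)\<^sup>2 \<le> log_bound a b c (4 - 4 * r)"
      using ineq u x unfolding ineq_holds_def by metis
    also have "\<dots> = (1 - r\<^sup>2) * X / (2 * pi)"
      using r by (subst log_bound_eq) (simp_all add: X_def L_def)
    finally show ?thesis
      using le by linarith
  qed
  also have "T / pi * (1 - r) = 2 * T * (1 - r) / (2 * pi)"
    by simp
  finally have "2 * T * (1 - r) \<le> (1 - r\<^sup>2) * X"
    by (simp only: divide_le_cancel) simp
  moreover have "0 < 2 * T * (1 - r)"
    using T0 r by simp
  ultimately have X: "2 * T * (1 - r) \<le> (1 - r\<^sup>2) * X" "0 < (1 - r\<^sup>2) * X"
    by linarith+
  \<comment> \<open>The constants may be negative, so positivity of \<open>X\<close> must come from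
    the inequality itself before 1 - r^2 is replaced by 2 (1 - r).\<close>
  then have "0 < X"
    using r2(3) by (simp add: zero_less_mult_iff)
  have "(1 - r\<^sup>2) * X \<le> 2 * (1 - r) * X"
    using r2 \<open>0 < X\<close> by (intro mult_right_mono) auto
  with X(1) have "(1 - r) * (2 * T) \<le> (1 - r) * (2 * X)"
    by (simp add: mult_ac)
  then have TX: "T \<le> X"
    using r by simp
  have M: "real M + 1 = exp T" "0 < real M"
    using T0(1) by (simp_all add: T(1))
  \<comment> \<open>Since T >= 2 pi, T / pi - 1 is at least T / (2 pi), and M < exp T. The factor T
    kept here becomes the - ln T in the bound on L.\<close>
  have "T / (8 * pi) * exp (- T) \<le> 1 - r\<^sup>2"
  proof -
    have "T / (8 * pi) * exp (- T) = (T / (2 * pi)) / (4 * exp T)"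
      by (simp add: exp_minus field_simps)
    also have "\<dots> \<le> (T / pi - 1) / (4 * real M)"
    proof (rule frac_le)
      have "1 \<le> T / (2 * pi)"
        using T(2) T0 by (subst pos_le_divide_eq) simp_all
      moreover have "T / pi = T / (2 * pi) + T / (2 * pi)"
        by simp
      ultimately show "T / (2 * pi) \<le> T / pi - 1" "0 \<le> T / pi - 1"
        by linarith+
    qed (use M in simp_all)
    finally show ?thesis
      using ge r2 by linarith
  qed
  then have "ln (T / (8 * pi) * exp (- T)) \<le> ln (1 - r\<^sup>2)"
    using T0 r2 by (subst ln_le_cancel_iff) auto
  then have L_le: "L \<le> T - ln T + ln (8 * pi)"
    using T0 by (simp add: L_def ln_mult ln_div)
  show ?thesis
  proof (rule that[OF _ L_le])
    show "0 \<le> L"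
      using r2 by (simp add: L_def)
    have "ln (8 * pi) \<le> ln T"
      using T T0 by (subst ln_le_cancel_iff) auto
    then show "L \<le> T"
      using L_le by linarith
  qed (use TX X_def in simp)
qed

lemma filterlim_ln_Suc: "filterlim (\<lambda>M. ln (real M + 1)) at_top sequentially"
  by real_asymp

text \<open>Otherwise T <= max a 0 T + ln (1 + T) + 2 pi for arbitrarily large T;
  \<open>max a 0\<close> allows monotonicity in L for negative \<open>a\<close> too.\<close>

lemma sharp_a:
  assumes "a < 1"
  shows "\<not> ineq_holds a 1 (2 * pi)"
proof
  assume ineq: "ineq_holds a 1 (2 * pi)"
  define d where "d = 1 - max a 0"
  have "d > 0"
    using assms by (simp add: d_def)
  have "\<forall>\<^sub>F T in at_top. ln (1 + T) + 2 * pi < d * T \<and> 8 * pi \<le> T"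
    using \<open>d > 0\<close> by (intro eventually_conj; real_asymp)
  from eventually_compose_filterlim[OF this filterlim_ln_Suc]
  obtain M where M: "ln (1 + ln (real M + 1)) + 2 * pi < d * ln (real M + 1)"
    "8 * pi \<le> ln (real M + 1)"
    unfolding eventually_sequentially by blast
  obtain L where L: "0 \<le> L" "L \<le> ln (real M + 1)" "ln (real M + 1) \<le> a * L + 1 * ln (1 + L) + 2 * pi"
    using ineq_holds_imp[OF ineq refl M(2)] by blast
  have "a * L \<le> max a 0 * ln (real M + 1)"
    using L by (intro mult_mono) auto
  moreover have "ln (1 + L) \<le> ln (1 + ln (real M + 1))"
    using L by simp
  ultimately show False
    using L M by (simp add: d_def algebra_simps)
qed

text \<open>With first coefficient 1 the T cancels: the deficit ln T in L would have to be covered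
  by max b 0 times ln T plus a constant.\<close>

lemma sharp_b:
  assumes "b < 1"
  shows "\<not> ineq_holds 1 b (2 * pi)"
proof
  assume ineq: "ineq_holds 1 b (2 * pi)"
  define d where "d = 1 - max b 0"
  define C where "C = ln (8 * pi) + max b 0 * ln 2 + 2 * pi"
  have "d > 0"
    using assms by (simp add: d_def)
  have "\<forall>\<^sub>F T in at_top. C < d * ln T \<and> 8 * pi \<le> T"
    using \<open>d > 0\<close> by (intro eventually_conj; real_asymp)
  from eventually_compose_filterlim[OF this filterlim_ln_Suc]
  obtain M where M: "C < d * ln (ln (real M + 1))" "8 * pi \<le> ln (real M + 1)"
    unfolding eventually_sequentially by blast
  define T where "T = ln (real M + 1)"
  have T: "1 \<le> T"
    using M(2) pi_gt3 unfolding T_def by linarith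
  obtain L where L: "0 \<le> L" "L \<le> T - ln T + ln (8 * pi)" "L \<le> T"
    "T \<le> 1 * L + b * ln (1 + L) + 2 * pi"
    using ineq_holds_imp[OF ineq T_def] M(2) unfolding T_def by blast
  have "ln (1 + L) \<le> ln (2 * T)"
    using L T by simp
  also have "\<dots> = ln 2 + ln T"
    using T by (simp add: ln_mult)
  finally have "b * ln (1 + L) \<le> max b 0 * (ln 2 + ln T)"
    using L by (intro mult_mono) auto
  then show False
    using L M(1) by (simp add: d_def C_def T_def algebra_simps)
qed

text \<open>At \<open>delta\<close> one has x = 4, where both logarithms vanish and the bound is c /
  (2 pi).\<close>

lemma sharp_c:
  assumes "c < 2 * pi"
  shows "\<not> ineq_holds 1 1 c"
proof
  assume "ineq_holds 1 1 c"
  moreover have delta: "delta \<noteq> (\<lambda>_. 0)"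
    by (auto simp: delta_def fun_eq_iff)
  ultimately have "(delta (0, 0))\<^sup>2 / (l2_norm delta)\<^sup>2
      \<le> log_bound 1 1 c (grad_norm_sq delta / (l2_norm delta)\<^sup>2)"
    by (simp add: ineq_holds_def delta_l2)
  moreover have "ip delta delta = 1" "ip (avg delta) delta = 0"
    by (simp_all add: ip_avg delta_l2 ip_delta) (simp_all add: avg_def delta_def)
  ultimately have "1 \<le> log_bound 1 1 c (4 - 4 * 0)"
    by (simp add: l2_norm_sq grad_norm_sq_eq delta_l2) (simp add: delta_def)
  then show False
    using assms by (simp only: log_bound_eq) simp
qed

theorem theorem3p3:
  "(\<forall>u \<in> l2_Z2. l2_norm u = 1 \<longrightarrow>
      (u (0, 0))\<^sup>2 \<le> log_bound 1 1 (2 * pi) (grad_norm_sq u)) \<and>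
   ineq_holds 1 1 (2 * pi) \<and>
   (\<forall>a < 1. \<not> ineq_holds a 1 (2 * pi)) \<and>
   (\<forall>b < 1. \<not> ineq_holds 1 b (2 * pi)) \<and>
   (\<forall>c < 2 * pi. \<not> ineq_holds 1 1 c) \<and>
   (\<forall>k u. k \<noteq> 0 \<and> u = (\<lambda>p. k * delta p) \<longrightarrow>
      u \<in> l2_Z2 \<and>
      (u (0, 0))\<^sup>2 / (l2_norm u)\<^sup>2
        = log_bound 1 1 (2 * pi) (grad_norm_sq u / (l2_norm u)\<^sup>2)) \<and>
   (\<forall>u \<in> l2_Z2. u \<noteq> (\<lambda>_. 0) \<and> (\<nexists>k. u = (\<lambda>p. k * delta p)) \<longrightarrow>
      (u (0, 0))\<^sup>2 / (l2_norm u)\<^sup>2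
        < log_bound 1 1 (2 * pi) (grad_norm_sq u / (l2_norm u)\<^sup>2))"
proof -
  have ineq: "(u (0, 0))\<^sup>2 / (l2_norm u)\<^sup>2
      \<le> log_bound 1 1 (2 * pi) (grad_norm_sq u / (l2_norm u)\<^sup>2)"
    if u: "u \<in> l2_Z2" "u \<noteq> (\<lambda>_. 0)" for u
  proof (cases "\<exists>k. u = (\<lambda>p. k * delta p)")
    case True
    then obtain k where k: "u = (\<lambda>p. k * delta p)" ..
    with u(2) have "k \<noteq> 0"
      by auto
    from delta_equality(2)[OF this k] show ?thesis
      by (rule eq_refl)
  next
    case False
    then show ?thesis
      using strict_bound[OF u] by simp
  qed
  show ?thesis
  proof (intro conjI ballI allI impI)
    fix u
    assume u: "u \<in> l2_Z2" "l2_norm u = 1"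
    then have "u \<noteq> (\<lambda>_. 0)"
      by (auto simp: l2_norm_def)
    then show "(u (0, 0))\<^sup>2 \<le> log_bound 1 1 (2 * pi) (grad_norm_sq u)"
      using ineq[OF u(1)] u(2) by simp
  next
    show "ineq_holds 1 1 (2 * pi)"
      unfolding ineq_holds_def using ineq by blast
  next
    fix k u
    assume "k \<noteq> (0::real) \<and> u = (\<lambda>p. k * delta p)"
    then have k: "k \<noteq> 0" "u = (\<lambda>p. k * delta p)"
      by (rule conjunct1, rule conjunct2)
    show "u \<in> l2_Z2"
      by (rule delta_equality(1)[OF k])
    show "(u (0, 0))\<^sup>2 / (l2_norm u)\<^sup>2
        = log_bound 1 1 (2 * pi) (grad_norm_sq u / (l2_norm u)\<^sup>2)"
      by (rule delta_equality(2)[OF k])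
  next
    fix u
    assume u: "u \<in> l2_Z2" and nd: "u \<noteq> (\<lambda>_. 0) \<and> (\<nexists>k. u = (\<lambda>p. k * delta p))"
    show "(u (0, 0))\<^sup>2 / (l2_norm u)\<^sup>2
        < log_bound 1 1 (2 * pi) (grad_norm_sq u / (l2_norm u)\<^sup>2)"
      by (rule strict_bound[OF u conjunct1[OF nd] conjunct2[OF nd]])
  qed (fact sharp_a sharp_b sharp_c)+
qed

end
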